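(* Let $k\ge 1$ be an integer, let $C\subseteq \mathbb{R}^k$ be a nonempty open convex set and let $f: C\to \mathbb{R}^k$ be a continuous injection with convex image. Fix also an integer $m\ge 2$, positive real weights $\alpha_1,\ldots,\alpha_m$ with sum $1$, and a $k$-dimensional subset $S\subseteq C$. Then the following are equivalent: (i) $\mathscr{M}^\omega(S)$ is relatively dense in $\mathrm{conv}(S)$; (ii) $f[\mathrm{int}(\mathrm{conv}(S))]\subseteq \mathrm{int}(\mathrm{conv}(f[S]))$. If, in addition, $S$ is compact, then they are also equivalent to: (iii) $f[\mathrm{conv}(S)]\subseteq \mathrm{conv}(f[S])$.
   Context: For $x_1,\ldots,x_m\in C$, the quasi-arithmetic mean with respect to $f$ and the weights $\alpha_1,\ldots,\alpha_m$ is $\mathsf{m}(x_1,\ldots,x_m):=f^{-1}\left(\alpha_1f(x_1)+\cdots+\alpha_mf(x_m)\right)\in C$ (well defined since $f$ is injective with convex image). For nonempty $A\subseteq C$, set $\mathscr{M}(A):=\{\mathsf{m}(x_1,\ldots,x_m): x_1,\ldots,x_m\in A\}$, $\mathscr{M}^0(A):=A$, $\mathscr{M}^{n+1}(A):=\mathscr{M}(\mathscr{M}^n(A))$ for integers $n\ge 0$, and $\mathscr{M}^\omega(A):=\bigcup_{n\ge 0}\mathscr{M}^n(A)$. $\mathrm{conv}(A)$ denotes the convex hull of $A$, $f[A]$ the image of $A$ under $f$, and $\mathrm{int}(A)$ the interior of $A$ in $\mathbb{R}^k$ (for subsets of the open set $C$ this is the same as the interior in the relative topology of $C$). A set $A\subseteq\mathbb{R}^k$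 is $k$-dimensional if it does not lie in an affine $(k-1)$-dimensional hyperplane, equivalently if $\mathrm{int}(\mathrm{conv}(A))\neq\emptyset$. Given $A,B\subseteq\mathbb{R}^k$, $A$ is relatively dense in $B$ if the closure of $A\cap B$ in the relative topology of $B$ coincides with $B$. *)

theory Defs
  imports "HOL-Analysis.Analysis"
begin

(* Tuples (x_1, ..., x_m) and weights (alpha_1, ..., alpha_m) are functions on nat,
   of which only the values on {1..m} are used. *)

definition qa_mean ::
  "(real ^ 'k) set \<Rightarrow> (real ^ 'k \<Rightarrow> real ^ 'k) \<Rightarrow> nat \<Rightarrow> (nat \<Rightarrow> real) \<Rightarrow> (nat \<Rightarrow> real ^ 'k) \<Rightarrow> real ^ 'k"
  where "qa_mean C f m \<alpha> x = inv_into C f (\<Sum>i=1..m. \<alpha> i *\<^sub>R f (x i))"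

definition qa_step ::
  "(real ^ 'k) set \<Rightarrow> (real ^ 'k \<Rightarrow> real ^ 'k) \<Rightarrow> nat \<Rightarrow> (nat \<Rightarrow> real) \<Rightarrow> (real ^ 'k) set \<Rightarrow> (real ^ 'k) set"
  where "qa_step C f m \<alpha> A = {qa_mean C f m \<alpha> x | x. \<forall>i\<in>{1..m}. x i \<in> A}"

definition qa_closure ::
  "(real ^ 'k) set \<Rightarrow> (real ^ 'k \<Rightarrow> real ^ 'k) \<Rightarrow> nat \<Rightarrow> (nat \<Rightarrow> real) \<Rightarrow> (real ^ 'k) set \<Rightarrow> (real ^ 'k) set"
  where "qa_closure C f m \<alpha> A = (\<Union>n. (qa_step C f m \<alpha> ^^ n) A)"

definition full_dimensional :: "(real ^ 'k) set \<Rightarrow> bool"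
  where "full_dimensional A \<longleftrightarrow>
    \<not> (\<exists>H. affine H \<and> aff_dim H = int CARD('k) - 1 \<and> A \<subseteq> H)"

definition relatively_dense :: "'a::topological_space set \<Rightarrow> 'a set \<Rightarrow> bool"
  where "relatively_dense A B \<longleftrightarrow> (top_of_set B) closure_of (A \<inter> B) = B"

end

theory Submission
  imports Defs
begin

text \<open>
  Conjugation by \<open>f\<close> turns the quasi-arithmetic mean into the weighted arithmetic mean, so the
  image under \<open>f\<close> of the closure of \<open>S\<close> under means lies in \<open>conv f[S]\<close>. Merging all weights but
  the first shows that the topological closure \<open>K\<close> of that image is stable under
  \<open>(x, y) \<mapsto> (1 - \<beta>) x + \<beta> y\<close> for some \<open>0 < \<beta> < 1\<close>. A closed set with this property is convex,
  so \<open>K\<close> is the closure of \<open>conv f[S]\<close>. By invariance of domain \<open>f\<close> is open, hence density of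
  the means in \<open>conv S\<close>, the inclusion of the open set \<open>f[int conv S]\<close> in \<open>K\<close>, and its inclusion
  in \<open>int K = int conv f[S]\<close> all say the same.
\<close>

section \<open>Closed sets stable under a fixed weighted mean\<close>

text \<open>A point \<open>u\<close> missing from \<open>T\<close> would lie in a gap between the
  largest element \<open>s\<close> of \<open>T\<close> below it and the smallest element
  \<open>t\<close> above it. The weighted mean of \<open>s\<close> and \<open>t\<close> would be an
  element of \<open>T\<close> strictly inside this gap.\<close>

lemma closed_stable_real_Icc:
  fixes T :: "real set" and \<beta> :: real
  assumes "closed T" "0 \<in> T" "1 \<in> T" "0 < \<beta>" "\<beta> < 1"
    and stable: "\<And>s t. s \<in> T \<Longrightarrow> t \<in> T \<Longrightarrow> (1 - \<beta>) * s + \<beta> * t \<in> T"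
  shows "{0..1} \<subseteq> T"
proof
  fix u :: real assume u: "u \<in> {0..1}"
  have "compact (T \<inter> {0..u})" "T \<inter> {0..u} \<noteq> {}" "compact (T \<inter> {u..1})" "T \<inter> {u..1} \<noteq> {}"
    using \<open>0 \<in> T\<close> \<open>1 \<in> T\<close> u by (auto intro!: closed_Int_compact \<open>closed T\<close>)
  then obtain s t where "s \<in> T \<inter> {0..u}" "\<forall>z\<in>T \<inter> {0..u}. z \<le> s"
    and "t \<in> T \<inter> {u..1}" "\<forall>z\<in>T \<inter> {u..1}. t \<le> z"
    using compact_attains_sup[of "T \<inter> {0..u}"] compact_attains_inf[of "T \<inter> {u..1}"] by blast
  then have s: "s \<in> T" "s \<le> u" "\<And>z. z \<in> T \<Longrightarrow> 0 \<le> z \<Longrightarrow> z \<le> u \<Longrightarrow> z \<le> s"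
    and t: "t \<in> T" "u \<le> t" "\<And>z. z \<in> T \<Longrightarrow> u \<le> z \<Longrightarrow> z \<le> 1 \<Longrightarrow> t \<le> z"
    and st: "0 \<le> s" "t \<le> 1"
    by auto
  show "u \<in> T"
  proof (rule ccontr)
    assume "u \<notin> T"
    with s t have "s < t"
      by (cases "s = t") auto
    define z where "z = (1 - \<beta>) * s + \<beta> * t"
    have "z - s = \<beta> * (t - s)" "t - z = (1 - \<beta>) * (t - s)"
      by (simp_all add: z_def algebra_simps)
    with \<open>s < t\<close> \<open>0 < \<beta>\<close> \<open>\<beta> < 1\<close> have "0 < z - s" "0 < t - z"
      by simp_all
    then have "s < z" "z < t"
      by simp_all
    moreover have "z \<in> T"
      unfolding z_def by (intro stable s t)
    ultimately show False
      using s(3)[of z] t(3)[of z] st by linarith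
  qed
qed

text \<open>Reduces to the real line: the parametrization \<open>g\<close> of a segment commutes
  with the weighted mean, so the parameters whose points lie in \<open>K\<close> form a closed
  stable set containing 0 and 1.\<close>

lemma closed_stable_imp_convex:
  fixes K :: "'a::real_normed_vector set" and \<beta> :: real
  assumes "closed K" "0 < \<beta>" "\<beta> < 1"
    and stable: "\<And>x y. x \<in> K \<Longrightarrow> y \<in> K \<Longrightarrow> (1 - \<beta>) *\<^sub>R x + \<beta> *\<^sub>R y \<in> K"
  shows "convex K"
  unfolding convex_alt
proof (intro ballI allI impI)
  fix x y and u :: real
  assume "x \<in> K" "y \<in> K" and u: "0 \<le> u \<and> u \<le> 1"
  define g where "g t = (1 - t) *\<^sub>R x + t *\<^sub>R y" for t :: real
  have "closed (g -` K)"
    unfolding g_def by (intro continuous_closed_vimage \<open>closed K\<close> continuous_intros)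
  moreover have "(1 - \<beta>) * s + \<beta> * t \<in> g -` K" if "s \<in> g -` K" "t \<in> g -` K" for s t
  proof -
    have "g ((1 - \<beta>) * s + \<beta> * t) = (1 - \<beta>) *\<^sub>R g s + \<beta> *\<^sub>R g t"
      by (simp add: g_def algebra_simps)
    with stable that show ?thesis by simp
  qed
  ultimately have "{0..1} \<subseteq> g -` K"
    using \<open>x \<in> K\<close> \<open>y \<in> K\<close> \<open>0 < \<beta>\<close> \<open>\<beta> < 1\<close>
    by (intro closed_stable_real_Icc) (auto simp: g_def)
  with u show "(1 - u) *\<^sub>R x + u *\<^sub>R y \<in> K"
    by (auto simp: g_def)
qed

section \<open>Relative density and full dimension\<close>

lemma relatively_dense_iff: "relatively_dense A B \<longleftrightarrow> B \<subseteq> closure (A \<inter> B)"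
  unfolding relatively_dense_def closure_of_subtopology
  by (simp add: Int_left_commute Int_commute inf.absorb_iff1)

lemma full_dimensional_imp_interior:
  fixes S :: "(real ^ 'k) set"
  assumes "full_dimensional S"
  shows "interior (convex hull S) \<noteq> {}"
proof
  assume "interior (convex hull S) = {}"
  \<comment> \<open>In full dimension the relative interior is the interior, so it would be empty;
    this forces the hull to be empty, and its dimension to be -1.\<close>
  then have "aff_dim (convex hull S) \<noteq> int DIM(real ^ 'k)"
    using interior_rel_interior_gen[of "convex hull S"]
    by (auto simp: rel_interior_eq_empty)
  then have "aff_dim S < DIM(real ^ 'k)"
    using aff_dim_le_DIM[of S] by (simp add: aff_dim_convex_hull)
  then obtain a b where "a \<noteq> 0" "S \<subseteq> {x. a \<bullet> x = b}"
    by (rule aff_lowdim_subset_hyperplane)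
  then have "affine {x. a \<bullet> x = b}" "aff_dim {x. a \<bullet> x = b} = int CARD('k) - 1"
    by (simp_all add: affine_hyperplane of_nat_diff Suc_leI)
  with \<open>S \<subseteq> {x. a \<bullet> x = b}\<close> assms show False
    unfolding full_dimensional_def by blast
qed

section \<open>Iterated means and their images under \<open>f\<close>\<close>

lemma qa_mean_image:
  assumes "convex (f ` C)" "\<And>i. i \<in> {1..m} \<Longrightarrow> \<alpha> i > 0" "(\<Sum>i=1..m. \<alpha> i) = 1"
    and "\<And>i. i \<in> {1..m} \<Longrightarrow> x i \<in> C"
  shows "qa_mean C f m \<alpha> x \<in> C" "f (qa_mean C f m \<alpha> x) = (\<Sum>i=1..m. \<alpha> i *\<^sub>R f (x i))"
proof -
  have "(\<Sum>i=1..m. \<alpha> i *\<^sub>R f (x i)) \<in> f ` C"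
    using assms by (intro convex_sum) (auto intro: less_imp_le)
  then show "qa_mean C f m \<alpha> x \<in> C" "f (qa_mean C f m \<alpha> x) = (\<Sum>i=1..m. \<alpha> i *\<^sub>R f (x i))"
    unfolding qa_mean_def by (rule inv_into_into, rule f_inv_into_f)
qed

lemma qa_closure_subset:
  assumes "convex (f ` C)" "\<And>i. i \<in> {1..m} \<Longrightarrow> \<alpha> i > 0" "(\<Sum>i=1..m. \<alpha> i) = 1" "S \<subseteq> C"
  shows "qa_closure C f m \<alpha> S \<subseteq> C" "f ` qa_closure C f m \<alpha> S \<subseteq> convex hull (f ` S)"
proof -
  \<comment> \<open>Both claims go through one induction: without the entries lying in
    \<open>C\<close>, the image of their mean could not be computed.\<close>
  have "(qa_step C f m \<alpha> ^^ n) S \<subseteq> {x \<in> C. f x \<in> convex hull (f ` S)}" for n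
  proof (induction n)
    case 0
    with \<open>S \<subseteq> C\<close> show ?case by (auto intro: hull_inc)
  next
    case (Suc n)
    have "qa_mean C f m \<alpha> x \<in> C \<and> f (qa_mean C f m \<alpha> x) \<in> convex hull (f ` S)"
      if "\<forall>i\<in>{1..m}. x i \<in> (qa_step C f m \<alpha> ^^ n) S" for x
    proof -
      have x: "x i \<in> C" "f (x i) \<in> convex hull (f ` S)" if "i \<in> {1..m}" for i
        using Suc.IH that \<open>\<forall>i\<in>{1..m}. _ i\<close> by blast+
      then have "(\<Sum>i=1..m. \<alpha> i *\<^sub>R f (x i)) \<in> convex hull (f ` S)"
        using assms by (intro convex_sum) (auto intro: less_imp_le)
      with qa_mean_image[of f C m \<alpha> x] assms x show ?thesis by simp
    qed
    then have "qa_step C f m \<alpha> ((qa_step C f m \<alpha> ^^ n) S) \<subseteq> {x \<in> C. f x \<in> convex hull (f ` S)}"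
      unfolding qa_step_def[of C f m \<alpha> "(qa_step C f m \<alpha> ^^ n) S"] by blast
    then show ?case by simp
  qed
  then show "qa_closure C f m \<alpha> S \<subseteq> C" "f ` qa_closure C f m \<alpha> S \<subseteq> convex hull (f ` S)"
    unfolding qa_closure_def by blast+
qed

lemma subset_qa_step:
  assumes "inj_on f C" "(\<Sum>i=1..m. \<alpha> i) = 1" "A \<subseteq> C"
  shows "A \<subseteq> qa_step C f m \<alpha> A"
proof
  fix a assume "a \<in> A"
  \<comment> \<open>A constant tuple is its own mean because the weights sum to 1.\<close>
  then have "qa_mean C f m \<alpha> (\<lambda>_. a) = a"
    unfolding qa_mean_def scaleR_left.sum[symmetric] assms(2) using assms(1,3) by auto
  with \<open>a \<in> A\<close> show "a \<in> qa_step C f m \<alpha> A"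
    unfolding qa_step_def by (auto intro!: exI[of _ "\<lambda>_. a"])
qed

text \<open>The points may appear at different stages, but the stages increase, so both lie in the
  later one and their mean in the stage after it.\<close>

lemma qa_mean_two_in_qa_closure:
  assumes "inj_on f C" "convex (f ` C)" "\<And>i. i \<in> {1..m} \<Longrightarrow> \<alpha> i > 0"
    and "(\<Sum>i=1..m. \<alpha> i) = 1" "S \<subseteq> C"
    and "a \<in> qa_closure C f m \<alpha> S" "b \<in> qa_closure C f m \<alpha> S"
  shows "qa_mean C f m \<alpha> (\<lambda>i. if i = 1 then a else b) \<in> qa_closure C f m \<alpha> S"
proof -
  let ?A = "\<lambda>n. (qa_step C f m \<alpha> ^^ n) S"
  have "?A n \<subseteq> C" for n
    using qa_closure_subset(1)[of f C m \<alpha> S] assms unfolding qa_closure_def by blast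
  then have "?A n \<subseteq> ?A (Suc n)" for n
    using subset_qa_step[of f C \<alpha> m "?A n"] assms by simp
  then have mono: "?A n \<subseteq> ?A n'" if "n \<le> n'" for n n'
    using lift_Suc_mono_le[of ?A] that by blast
  obtain n n' where "a \<in> ?A n" "b \<in> ?A n'"
    using assms unfolding qa_closure_def by blast
  with mono[of n "max n n'"] mono[of n' "max n n'"]
  have "a \<in> ?A (max n n')" "b \<in> ?A (max n n')"
    by auto
  then have "qa_mean C f m \<alpha> (\<lambda>i. if i = 1 then a else b) \<in> qa_step C f m \<alpha> (?A (max n n'))"
    unfolding qa_step_def[of C f m \<alpha> "?A (max n n')"] by auto
  then have "qa_mean C f m \<alpha> (\<lambda>i. if i = 1 then a else b) \<in> ?A (Suc (max n n'))"
    by simp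
  then show ?thesis
    unfolding qa_closure_def by blast
qed

lemma closure_image_qa_closure:
  assumes "inj_on f C" "convex (f ` C)" "m \<ge> 2" "\<And>i. i \<in> {1..m} \<Longrightarrow> \<alpha> i > 0"
    and "(\<Sum>i=1..m. \<alpha> i) = 1" "S \<subseteq> C"
  shows "closure (f ` qa_closure C f m \<alpha> S) = closure (convex hull (f ` S))"
proof
  let ?X = "qa_closure C f m \<alpha> S"
  \<comment> \<open>The merged weight of all indices but the first: positive since
    \<open>m \<ge> 2\<close>, and below 1 since \<open>\<alpha> 1 > 0\<close>.\<close>
  define \<beta> where "\<beta> = (\<Sum>i=2..m. \<alpha> i)"
  have split: "{1..m} = insert 1 {2..m}"
    using \<open>m \<ge> 2\<close> by auto
  have "\<beta> > 0"
    unfolding \<beta>_def using assms by (intro sum_pos) auto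
  have \<alpha>1: "\<alpha> 1 = 1 - \<beta>" "\<alpha> 1 > 0"
    using assms(3) assms(4)[of 1] assms(5) unfolding split \<beta>_def by auto
  have stable: "(1 - \<beta>) *\<^sub>R u + \<beta> *\<^sub>R v \<in> f ` ?X" if uv: "u \<in> f ` ?X" "v \<in> f ` ?X" for u v
  proof -
    obtain a b where ab: "a \<in> ?X" "b \<in> ?X" "u = f a" "v = f b"
      using uv by blast
    define x where "x = (\<lambda>i::nat. if i = 1 then a else b)"
    have "?X \<subseteq> C"
      using qa_closure_subset(1)[of f C m \<alpha> S] assms by blast
    then have "f (qa_mean C f m \<alpha> x) = (\<Sum>i=1..m. \<alpha> i *\<^sub>R f (x i))"
      using assms ab by (intro qa_mean_image(2)) (auto simp: x_def)
    also have "\<dots> = (1 - \<beta>) *\<^sub>R u + \<beta> *\<^sub>R v"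
      using \<alpha>1 unfolding split by (simp add: x_def ab \<beta>_def scaleR_left.sum)
    finally have "(1 - \<beta>) *\<^sub>R u + \<beta> *\<^sub>R v = f (qa_mean C f m \<alpha> x)" ..
    moreover have "qa_mean C f m \<alpha> x \<in> ?X"
      unfolding x_def by (rule qa_mean_two_in_qa_closure) (use assms ab in auto)
    ultimately show ?thesis by blast
  qed
  have "convex (closure (f ` ?X))"
  proof (rule closed_stable_imp_convex[OF closed_closure \<open>\<beta> > 0\<close>])
    show "\<beta> < 1" using \<alpha>1 by simp
    fix u v assume "u \<in> closure (f ` ?X)" "v \<in> closure (f ` ?X)"
    then obtain p q where "\<And>n. p n \<in> f ` ?X" "p \<longlonglongrightarrow> u" "\<And>n. q n \<in> f ` ?X" "q \<longlonglongrightarrow> v"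
      using closure_sequential[of u "f ` ?X"] closure_sequential[of v "f ` ?X"] by blast
    then have "(\<lambda>n. (1 - \<beta>) *\<^sub>R p n + \<beta> *\<^sub>R q n) \<longlonglongrightarrow> (1 - \<beta>) *\<^sub>R u + \<beta> *\<^sub>R v"
      "(1 - \<beta>) *\<^sub>R p n + \<beta> *\<^sub>R q n \<in> closure (f ` ?X)" for n
      by (auto intro!: tendsto_intros stable closure_subset[THEN subsetD])
    then show "(1 - \<beta>) *\<^sub>R u + \<beta> *\<^sub>R v \<in> closure (f ` ?X)"
      using closed_sequentially[of "closure (f ` ?X)" "\<lambda>n. (1 - \<beta>) *\<^sub>R p n + \<beta> *\<^sub>R q n"] by simp
  qed
  moreover have "(qa_step C f m \<alpha> ^^ 0) S \<subseteq> ?X"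
    unfolding qa_closure_def by blast
  then have "f ` S \<subseteq> closure (f ` ?X)"
    using closure_subset[of "f ` ?X"] by auto
  ultimately show "closure (convex hull (f ` S)) \<subseteq> closure (f ` ?X)"
    by (intro closure_minimal hull_minimal) auto
  show "closure (f ` ?X) \<subseteq> closure (convex hull (f ` S))"
    using assms by (intro closure_mono qa_closure_subset) auto
qed

section \<open>The equivalences\<close>

theorem theorem2p1:
  fixes C S :: "(real ^ 'k) set"
    and f :: "real ^ 'k \<Rightarrow> real ^ 'k"
    and m :: nat
    and \<alpha> :: "nat \<Rightarrow> real"
  assumes "C \<noteq> {}" and "open C" and "convex C"
    and "continuous_on C f" and "inj_on f C" and "convex (f ` C)"
    and "m \<ge> 2"
    and "\<And>i. i \<in> {1..m} \<Longrightarrow> \<alpha> i > 0"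
    and "(\<Sum>i=1..m. \<alpha> i) = 1"
    and "S \<subseteq> C" and "full_dimensional S"
  shows "(relatively_dense (qa_closure C f m \<alpha> S) (convex hull S)
            \<longleftrightarrow> f ` interior (convex hull S) \<subseteq> interior (convex hull (f ` S)))
       \<and> (compact S \<longrightarrow>
            (relatively_dense (qa_closure C f m \<alpha> S) (convex hull S)
              \<longleftrightarrow> f ` (convex hull S) \<subseteq> convex hull (f ` S))
          \<and> (f ` interior (convex hull S) \<subseteq> interior (convex hull (f ` S))
              \<longleftrightarrow> f ` (convex hull S) \<subseteq> convex hull (f ` S)))"
proof -
  define X where "X = qa_closure C f m \<alpha> S"
  define I where "I = interior (convex hull S)"
  have dense: "closure (f ` X) = closure (convex hull (f ` S))"
    unfolding X_def using assms by (intro closure_image_qa_closure) auto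
  have "X \<subseteq> C"
    unfolding X_def using assms by (intro qa_closure_subset) auto
  have hullC: "convex hull S \<subseteq> C"
    using \<open>S \<subseteq> C\<close> \<open>convex C\<close> by (rule hull_minimal)
  have I: "I \<subseteq> convex hull S" "open I" "I \<subseteq> C"
    using interior_subset hullC unfolding I_def by blast+
  \<comment> \<open>A convex set with nonempty interior lies in the closure of that interior; this
    is where full dimension enters.\<close>
  have closure_I: "convex hull S \<subseteq> closure I"
    using convex_closure_interior[OF convex_convex_hull full_dimensional_imp_interior]
      \<open>full_dimensional S\<close> closure_subset unfolding I_def by blast
  have open_image: "open (f ` V)" if "open V" "V \<subseteq> C" for V
    using that assms by (meson continuous_on_subset inj_on_subset invariance_of_domain)

  have i_ii: "relatively_dense X (convex hull S) \<longleftrightarrow> f ` I \<subseteq> interior (convex hull (f ` S))"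
  proof
    assume "relatively_dense X (convex hull S)"
    then have "I \<subseteq> closure X"
      using I closure_mono[of "X \<inter> convex hull S" X] unfolding relatively_dense_iff by blast
    have "f ` I \<subseteq> closure (f ` X)"
    proof clarify
      fix z assume "z \<in> I"
      with \<open>I \<subseteq> closure X\<close> obtain p where p: "\<And>n. p n \<in> X" "p \<longlonglongrightarrow> z"
        using closure_sequential[of z X] by blast
      moreover have "z \<in> C"
        using \<open>z \<in> I\<close> I by blast
      ultimately have "(\<lambda>n. f (p n)) \<longlonglongrightarrow> f z"
        using \<open>X \<subseteq> C\<close>
        by (intro continuous_on_tendsto_compose[OF assms(4)]) (auto intro: always_eventually)
      moreover have "f (p n) \<in> closure (f ` X)" for n
        using p(1) closure_subset by blast
      ultimately show "f z \<in> closure (f ` X)"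
        using closed_sequentially[of "closure (f ` X)" "\<lambda>n. f (p n)"] by simp
    qed
    \<comment> \<open>The image of \<open>I\<close> is open, so it lies in the interior of the
      closed set; a convex set and its closure have the same interior.\<close>
    then have "f ` I \<subseteq> interior (closure (convex hull (f ` S)))"
      unfolding dense using open_image[OF \<open>open I\<close> \<open>I \<subseteq> C\<close>] by (rule interior_maximal)
    then show "f ` I \<subseteq> interior (convex hull (f ` S))"
      by (simp add: convex_interior_closure)
  next
    assume "f ` I \<subseteq> interior (convex hull (f ` S))"
    then have sub: "f ` I \<subseteq> closure (f ` X)"
      using interior_subset closure_subset unfolding dense by blast
    have "I \<subseteq> closure (X \<inter> I)"
    proof
      fix z assume "z \<in> I"
      show "z \<in> closure (X \<inter> I)"
        unfolding closure_iff_nhds_not_empty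
      proof (intro allI impI)
        fix A V assume "V \<subseteq> A" "open V" "z \<in> V"
        then have "open (f ` (V \<inter> I))" "f z \<in> f ` (V \<inter> I)"
          using I \<open>z \<in> I\<close> by (auto intro!: open_image)
        moreover have "f z \<in> closure (f ` X)"
          using sub \<open>z \<in> I\<close> by blast
        ultimately have "f ` (V \<inter> I) \<inter> f ` X \<noteq> {}"
          by (meson closure_iff_nhds_not_empty disjoint_iff subset_refl)
        then obtain v x where "v \<in> V \<inter> I" "x \<in> X" "f v = f x"
          by auto
        then have "v = x"
          using \<open>inj_on f C\<close> \<open>X \<subseteq> C\<close> \<open>I \<subseteq> C\<close> by (auto dest: inj_onD)
        with \<open>v \<in> V \<inter> I\<close> \<open>x \<in> X\<close> \<open>V \<subseteq> A\<close> show "X \<inter> I \<inter> A \<noteq> {}"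
          by blast
      qed
    qed
    also have "\<dots> \<subseteq> closure (X \<inter> convex hull S)"
      using I by (intro closure_mono) blast
    finally have "closure I \<subseteq> closure (X \<inter> convex hull S)"
      by (intro closure_minimal) auto
    with closure_I show "relatively_dense X (convex hull S)"
      unfolding relatively_dense_iff by blast
  qed

  have ii_iii: "f ` I \<subseteq> interior (convex hull (f ` S)) \<longleftrightarrow> f ` (convex hull S) \<subseteq> convex hull (f ` S)"
    if "compact S"
  proof
    assume "f ` I \<subseteq> interior (convex hull (f ` S))"
    then have "f ` I \<subseteq> convex hull (f ` S)"
      using interior_subset by blast
    \<comment> \<open>Compactness keeps \<open>closure I\<close> inside the hull, hence inside
      \<open>C\<close>, where \<open>f\<close> is continuous; it also makes the target hull closed,
      so the inclusion extends from \<open>I\<close> to its closure.\<close>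
    moreover have "compact (convex hull S)"
      using that by (rule compact_convex_hull)
    then have "closure I \<subseteq> convex hull S"
      using I by (intro closure_minimal compact_imp_closed)
    then have "continuous_on (closure I) f"
      using assms(4) hullC by (meson continuous_on_subset order_trans)
    moreover have "compact (convex hull (f ` S))"
      using that assms by (meson compact_continuous_image compact_convex_hull continuous_on_subset)
    ultimately have "f ` closure I \<subseteq> convex hull (f ` S)"
      by (intro image_closure_subset compact_imp_closed)
    with closure_I show "f ` (convex hull S) \<subseteq> convex hull (f ` S)"
      by blast
  next
    assume "f ` (convex hull S) \<subseteq> convex hull (f ` S)"
    with I open_image show "f ` I \<subseteq> interior (convex hull (f ` S))"
      by (intro interior_maximal) blast+
  qed
  show ?thesis
    using i_ii ii_iii unfolding X_def I_def by blast
qed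

end
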